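(* Let $m\in\mathbb N$, $\varepsilon\in[-1,1]$, let $f$ be a hint function, and let $T$ be any (possibly randomized) strategy for the $m$-round online binomial game $G_{m,\varepsilon,f}$. For $v\in\widehat V$ let $a^T_v=\Pr[U_T=v]$ (probability over the randomness of both the game and the strategy). Then $(a^T_v)_{v\in\widehat V}$ is a feasible solution of the linear program (P): $$\max\ \sum_{v\in\widehat V}a_v\,(c_v-v_v)\quad\text{s.t.}\quad a_v+\sum_{u\in\widehat V:\,u<v}a_u\Pr[v\mid u]\le\Pr[v]\ \ \forall v\in\widehat V,\qquad a_v\ge0\ \ \forall v\in\widehat V .$$ Moreover, the objective value $\sum_{v\in\widehat V}a^T_v(c_v-v_v)$ equals the bias $\mathrm{bias}_T$ obtained by the strategy $T$.
   Context: Distributions: for $\varepsilon\in[-1,1]$, $\mathcal C_{\varepsilon}$ is the distribution on $\{-1,1\}$ giving $1$ probability $\frac12(1+\varepsilon)$; $\mathcal C_{n,\varepsilon}$ is the distribution of the sum of $n$ independent $\mathcal C_\varepsilon$ variables. Online binomial game: let $f$ be a randomized function (with discrete values) on $[m]\times\mathbb Z\times\mathbb Z$, called the hint function. In the $m$-round game $G_{m,\varepsilon,f}$, independent coins $C_i\leftarrow\mathcal C_{(m-i+1)^2,\varepsilon}$, $i\in[m]$, are drawn; $S_0=0$, $S_i=\sum_{j\le i}C_j$, and the hint of round $i$ is $H_i=f(i,S_{i-1},C_i)$ (with fresh independent randomness of $f$ in each round). A strategy $T$ is a (possibly randomized, possibly stateful) algorithm which in round $i=1,\dots,m$ receives $(S_{i-1},H_i)$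 and outputs a bit, using private randomness independent of the game; $I_T$ is the first round in which it outputs $1$ ("aborts"), and $I_T=m+1$ if it never does. Let $\delta_i(b)=\Pr[S_m\ge0\mid S_{i-1}=b]$, $\delta_i(b,h)=\Pr[S_m\ge0\mid S_{i-1}=b,H_i=h]$, and for $i\in[m]$ let $O_i=\delta_i(S_{i-1},H_i)$, $O_i^-=\delta_i(S_{i-1})$, while $O_{m+1}=O^-_{m+1}$ is the indicator of $S_m\ge0$. The (signed) bias of $T$ is $\mathrm{bias}_T=\mathbb E[O^-_{I_T}-O_{I_T}]$. States: a with-hint state $u=\langle\ell,b,h\rangle$ with level $\ell\in[m]$ is the event $\{S_{m-\ell}=b,\ H_{m-\ell+1}=h\}$, and $u^-=\langle\ell,b\rangle$ is the event $\{S_{m-\ell}=b\}$. A final state $\langle0,b\rangle$ is the event $\{S_m=b\}$; for it $u^-=u$. $\widehat V$ is the set of all with-hint states and final states (of positive probability). $u<v$ means $u$ occurs in a strictly earlier round than $v$, i.e. the level of $u$ is strictly larger than that of $v$. For a state $u$, $c_u=\Pr[S_m\ge0\mid u^-]$ and $v_u=\Pr[S_m\ge 0\mid u]$. $U_T$ is the state in which $T$ stops: $U_T=\langle\ell,b,h\rangle$ if $I_T=m-\ell+1\le m$, $S_{m-\ell}=b$, $H_{m-\ell+1}=h$; and $U_T=\langle0,b\rangle$ if $I_T=m+1$ and $S_m=b$. *)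

theory Defs
  imports "HOL-Probability.Probability"
begin

section \<open>Coins and the online binomial game\<close>

definition coin_pmf :: "real \<Rightarrow> int pmf" where
  "coin_pmf \<epsilon> = map_pmf (\<lambda>b. if b then 1 else -1) (bernoulli_pmf ((1 + \<epsilon>) / 2))"

definition coin_sum_pmf :: "nat \<Rightarrow> real \<Rightarrow> int pmf" where
  "coin_sum_pmf n \<epsilon> =
     map_pmf (\<lambda>x. \<Sum>k<n. x k) (Pi_pmf {..<n} 0 (\<lambda>_. coin_pmf \<epsilon>))"

text \<open>
  An outcome \<open>\<omega>\<close> of the game is a pair of the coins and the hints, both indexed by rounds
  \<open>1, \<dots>, m\<close>. The randomized hint function is a family \<open>f i b c\<close> of
  distributions; every pmf has countable support, so its values are discrete for any type
  \<open>'h\<close> of hints.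
\<close>

type_synonym 'h outcome = "(nat \<Rightarrow> int) \<times> (nat \<Rightarrow> 'h)"
type_synonym 'h hint_fun = "nat \<Rightarrow> int \<Rightarrow> int \<Rightarrow> 'h pmf"

definition coin :: "'h outcome \<Rightarrow> nat \<Rightarrow> int" where
  "coin \<omega> i = fst \<omega> i"

definition hint :: "'h outcome \<Rightarrow> nat \<Rightarrow> 'h" where
  "hint \<omega> i = snd \<omega> i"

definition partial_sum :: "'h outcome \<Rightarrow> nat \<Rightarrow> int" where
  "partial_sum \<omega> i = (\<Sum>j\<in>{1..i}. coin \<omega> j)"

definition game :: "nat \<Rightarrow> real \<Rightarrow> 'h hint_fun \<Rightarrow> 'h outcome pmf" where
  "game m \<epsilon> f =
     bind_pmf (Pi_pmf {1..m} 0 (\<lambda>i. coin_sum_pmf ((m - i + 1)\<^sup>2) \<epsilon>)) (\<lambda>c.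
     bind_pmf (Pi_pmf {1..m} undefined (\<lambda>i. f i (\<Sum>j\<in>{1..i - 1}. c j) (c i))) (\<lambda>h.
     return_pmf (c, h)))"


section \<open>Strategies\<close>

text \<open>
  A strategy consists of a probability space \<open>R\<close> of private randomness and a map \<open>T\<close>,
  where \<open>T r [(S\<^sub>0, H\<^sub>1), \<dots>, (S\<^sub>i\<^sub>-\<^sub>1, H\<^sub>i)]\<close> is the bit output in round \<open>i\<close> if the private
  randomness is \<open>r\<close>. Since \<open>T\<close> sees everything received so far, it can recompute any internal
  state; the round number is the length of the list.
\<close>

definition is_strategy :: "'r measure \<Rightarrow> ('r \<Rightarrow> (int \<times> 'h) list \<Rightarrow> bool) \<Rightarrow> bool" where
  "is_strategy R T \<longleftrightarrow> prob_space R \<and>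
     (\<lambda>(r, xs). T r xs) \<in> R \<Otimes>\<^sub>M count_space UNIV \<rightarrow>\<^sub>M count_space UNIV"

definition history :: "'h outcome \<Rightarrow> nat \<Rightarrow> (int \<times> 'h) list" where
  "history \<omega> i = map (\<lambda>j. (partial_sum \<omega> (j - 1), hint \<omega> j)) [1..<i + 1]"

text \<open>The private randomness is independent of the game, hence the product measure.\<close>

definition joint_space :: "'r measure \<Rightarrow> nat \<Rightarrow> real \<Rightarrow> 'h hint_fun \<Rightarrow> ('r \<times> 'h outcome) measure" where
  "joint_space R m \<epsilon> f = R \<Otimes>\<^sub>M measure_pmf (game m \<epsilon> f)"

definition abort_round :: "nat \<Rightarrow> ('r \<Rightarrow> (int \<times> 'h) list \<Rightarrow> bool) \<Rightarrow> 'r \<Rightarrow> 'h outcome \<Rightarrow> nat" where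
  "abort_round m T r \<omega> =
     (if \<exists>i\<in>{1..m}. T r (history \<omega> i)
      then (LEAST i. i \<in> {1..m} \<and> T r (history \<omega> i)) else m + 1)"


section \<open>The bias of a strategy\<close>

definition delta :: "nat \<Rightarrow> real \<Rightarrow> 'h hint_fun \<Rightarrow> nat \<Rightarrow> int \<Rightarrow> real" where
  "delta m \<epsilon> f i b =
     \<P>(\<omega> in measure_pmf (game m \<epsilon> f). partial_sum \<omega> m \<ge> 0 \<bar> partial_sum \<omega> (i - 1) = b)"

definition delta_hint :: "nat \<Rightarrow> real \<Rightarrow> 'h hint_fun \<Rightarrow> nat \<Rightarrow> int \<Rightarrow> 'h \<Rightarrow> real" where
  "delta_hint m \<epsilon> f i b h =
     \<P>(\<omega> in measure_pmf (game m \<epsilon> f).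
        partial_sum \<omega> m \<ge> 0 \<bar> partial_sum \<omega> (i - 1) = b \<and> hint \<omega> i = h)"

definition O_hint :: "nat \<Rightarrow> real \<Rightarrow> 'h hint_fun \<Rightarrow> nat \<Rightarrow> 'h outcome \<Rightarrow> real" where
  "O_hint m \<epsilon> f i \<omega> =
     (if i \<le> m then delta_hint m \<epsilon> f i (partial_sum \<omega> (i - 1)) (hint \<omega> i)
      else of_bool (partial_sum \<omega> m \<ge> 0))"

definition O_minus :: "nat \<Rightarrow> real \<Rightarrow> 'h hint_fun \<Rightarrow> nat \<Rightarrow> 'h outcome \<Rightarrow> real" where
  "O_minus m \<epsilon> f i \<omega> =
     (if i \<le> m then delta m \<epsilon> f i (partial_sum \<omega> (i - 1))
      else of_bool (partial_sum \<omega> m \<ge> 0))"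

definition bias :: "nat \<Rightarrow> real \<Rightarrow> 'h hint_fun \<Rightarrow> 'r measure \<Rightarrow> ('r \<Rightarrow> (int \<times> 'h) list \<Rightarrow> bool) \<Rightarrow> real" where
  "bias m \<epsilon> f R T =
     (LINT (r, \<omega>) | joint_space R m \<epsilon> f.
        O_minus m \<epsilon> f (abort_round m T r \<omega>) \<omega> - O_hint m \<epsilon> f (abort_round m T r \<omega>) \<omega>)"


section \<open>States\<close>

text \<open>
  \<open>With_Hint l b h\<close> is \<open>\<langle>l, b, h\<rangle>\<close> and \<open>Without_Hint l b\<close> is \<open>\<langle>l, b\<rangle>\<close>; the final states are
  those of the form \<open>Without_Hint 0 b\<close>. States are kept apart by their level even when they
  denote the same event.
\<close>

datatype 'h state = With_Hint nat int 'h | Without_Hint nat int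

primrec level :: "'h state \<Rightarrow> nat" where
  "level (With_Hint l b h) = l"
| "level (Without_Hint l b) = l"

primrec drop_hint :: "'h state \<Rightarrow> 'h state" where
  "drop_hint (With_Hint l b h) = Without_Hint l b"
| "drop_hint (Without_Hint l b) = Without_Hint l b"

primrec occurs :: "nat \<Rightarrow> 'h state \<Rightarrow> 'h outcome \<Rightarrow> bool" where
  "occurs m (With_Hint l b h) \<omega> \<longleftrightarrow> partial_sum \<omega> (m - l) = b \<and> hint \<omega> (m - l + 1) = h"
| "occurs m (Without_Hint l b) \<omega> \<longleftrightarrow> partial_sum \<omega> (m - l) = b"

definition state_prob :: "nat \<Rightarrow> real \<Rightarrow> 'h hint_fun \<Rightarrow> 'h state \<Rightarrow> real" where
  "state_prob m \<epsilon> f v = \<P>(\<omega> in measure_pmf (game m \<epsilon> f). occurs m v \<omega>)"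

text \<open>\<open>trans_prob m \<epsilon> f u v\<close> is \<open>Pr[v | u]\<close>.\<close>

definition trans_prob :: "nat \<Rightarrow> real \<Rightarrow> 'h hint_fun \<Rightarrow> 'h state \<Rightarrow> 'h state \<Rightarrow> real" where
  "trans_prob m \<epsilon> f u v =
     \<P>(\<omega> in measure_pmf (game m \<epsilon> f). occurs m v \<omega> \<bar> occurs m u \<omega>)"

definition V_hat :: "nat \<Rightarrow> real \<Rightarrow> 'h hint_fun \<Rightarrow> 'h state set" where
  "V_hat m \<epsilon> f =
     {v. ((\<exists>l\<in>{1..m}. \<exists>b h. v = With_Hint l b h) \<or> (\<exists>b. v = Without_Hint 0 b))
         \<and> state_prob m \<epsilon> f v > 0}"

definition earlier :: "'h state \<Rightarrow> 'h state \<Rightarrow> bool" where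
  "earlier u v \<longleftrightarrow> level u > level v"

definition state_v :: "nat \<Rightarrow> real \<Rightarrow> 'h hint_fun \<Rightarrow> 'h state \<Rightarrow> real" where
  "state_v m \<epsilon> f u =
     \<P>(\<omega> in measure_pmf (game m \<epsilon> f). partial_sum \<omega> m \<ge> 0 \<bar> occurs m u \<omega>)"

definition state_c :: "nat \<Rightarrow> real \<Rightarrow> 'h hint_fun \<Rightarrow> 'h state \<Rightarrow> real" where
  "state_c m \<epsilon> f u =
     \<P>(\<omega> in measure_pmf (game m \<epsilon> f). partial_sum \<omega> m \<ge> 0 \<bar> occurs m (drop_hint u) \<omega>)"

definition stop_state :: "nat \<Rightarrow> ('r \<Rightarrow> (int \<times> 'h) list \<Rightarrow> bool) \<Rightarrow> 'r \<Rightarrow> 'h outcome \<Rightarrow> 'h state" where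
  "stop_state m T r \<omega> =
     (let i = abort_round m T r \<omega> in
      if i \<le> m then With_Hint (m - i + 1) (partial_sum \<omega> (i - 1)) (hint \<omega> i)
      else Without_Hint 0 (partial_sum \<omega> m))"

definition stop_prob ::
  "nat \<Rightarrow> real \<Rightarrow> 'h hint_fun \<Rightarrow> 'r measure \<Rightarrow> ('r \<Rightarrow> (int \<times> 'h) list \<Rightarrow> bool) \<Rightarrow> 'h state \<Rightarrow> real" where
  "stop_prob m \<epsilon> f R T v =
     \<P>(x in joint_space R m \<epsilon> f. stop_state m T (fst x) (snd x) = v)"


section \<open>The linear program\<close>

text \<open>
  The set of states may be countably infinite, so the sums are unconditional infinite sums.
  As \<open>infsum\<close> is 0 on divergent families, summability is an explicit part of feasibility.
\<close>

definition lp_feasible :: "nat \<Rightarrow> real \<Rightarrow> 'h hint_fun \<Rightarrow> ('h state \<Rightarrow> real) \<Rightarrow> bool" where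
  "lp_feasible m \<epsilon> f a \<longleftrightarrow>
     (\<forall>v\<in>V_hat m \<epsilon> f.
        (\<lambda>u. a u * trans_prob m \<epsilon> f u v) summable_on {u \<in> V_hat m \<epsilon> f. earlier u v} \<and>
        a v + (\<Sum>\<^sub>\<infinity>u\<in>{u \<in> V_hat m \<epsilon> f. earlier u v}. a u * trans_prob m \<epsilon> f u v)
          \<le> state_prob m \<epsilon> f v) \<and>
     (\<forall>v\<in>V_hat m \<epsilon> f. a v \<ge> 0)"

definition lp_objective :: "nat \<Rightarrow> real \<Rightarrow> 'h hint_fun \<Rightarrow> ('h state \<Rightarrow> real) \<Rightarrow> real" where
  "lp_objective m \<epsilon> f a =
     (\<Sum>\<^sub>\<infinity>v\<in>V_hat m \<epsilon> f. a v * (state_c m \<epsilon> f v - state_v m \<epsilon> f v))"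

end

theory Submission
  imports Defs
begin

text \<open>
  Whether the strategy stops in \<open>u = \<langle>l, b, h\<rangle>\<close> is decided by the private randomness, the rounds before
  \<open>u\<close> and \<open>u\<close> itself. By the Markov property of the game it is therefore independent, given \<open>u\<close>, of every
  later state \<open>v\<close>, so that \<open>a\<^sub>u \<cdot> Pr[v | u]\<close> is the probability of stopping in \<open>u\<close> and then passing
  through \<open>v\<close>. For distinct \<open>u\<close> these events are disjoint, they are disjoint from stopping in \<open>v\<close>, and
  all of them imply \<open>v\<close>; this is the constraint of the linear program at \<open>v\<close>. The bias is the expectation of
  \<open>c\<^sub>u - v\<^sub>u\<close> at the state \<open>u\<close> of stopping, which is a discrete random variable.
\<close>

section \<open>Cutting the game at a round\<close>

text \<open>Rounds \<open>a + 1, \<dots>, b\<close> of the game when the sum of the coins so far is \<open>s\<close>.\<close>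

definition segment ::
  "nat \<Rightarrow> real \<Rightarrow> 'h hint_fun \<Rightarrow> nat \<Rightarrow> nat \<Rightarrow> int \<Rightarrow> 'h outcome pmf" where
  "segment m \<epsilon> f a b s =
     bind_pmf (Pi_pmf {a<..b} 0 (\<lambda>i. coin_sum_pmf ((m - i + 1)\<^sup>2) \<epsilon>)) (\<lambda>c.
     bind_pmf (Pi_pmf {a<..b} undefined (\<lambda>i. f i (s + (\<Sum>j\<in>{a<..i - 1}. c j)) (c i))) (\<lambda>h.
     return_pmf (c, h)))"

text \<open>The case distinction is that of \<open>Pi_pmf_union\<close>: index 0 and the indices
  beyond the last round come from the second outcome, which has the default values there when it is
  drawn from \<open>segment\<close>.\<close>

definition concat_at :: "nat \<Rightarrow> 'h outcome \<Rightarrow> 'h outcome \<Rightarrow> 'h outcome" where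
  "concat_at k \<omega> \<omega>' =
     (\<lambda>i. if i \<in> {0<..k} then fst \<omega> i else fst \<omega>' i,
      \<lambda>i. if i \<in> {0<..k} then snd \<omega> i else snd \<omega>' i)"

lemma partial_sum_cong:
  "(\<And>j. j \<in> {0<..i} \<Longrightarrow> fst \<omega> j = fst \<omega>' j) \<Longrightarrow> partial_sum \<omega> i = partial_sum \<omega>' i"
  unfolding partial_sum_def coin_def by (intro sum.cong) auto

lemma partial_sum_split:
  assumes "k \<le> i"
  shows "partial_sum \<omega> i = partial_sum \<omega> k + (\<Sum>j\<in>{k<..i}. fst \<omega> j)"
proof -
  have "{1..i} = {1..k} \<union> {k<..i}" using assms by auto
  then show ?thesis
    unfolding partial_sum_def coin_def by (simp only:) (intro sum.union_disjoint, auto)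
qed

text \<open>The later coins are independent of the earlier hints, so the draws can be reordered into
  rounds up to \<open>k\<close> followed by the rest; the later hints see the earlier coins only
  through their sum.\<close>

lemma game_split:
  assumes "k \<le> m"
  shows "game m \<epsilon> f = bind_pmf (segment m \<epsilon> f 0 k 0) (\<lambda>\<omega>.
           map_pmf (concat_at k \<omega>) (segment m \<epsilon> f k m (partial_sum \<omega> k)))"
proof -
  let ?C = "\<lambda>A. Pi_pmf A 0 (\<lambda>i. coin_sum_pmf ((m - i + 1)\<^sup>2) \<epsilon>)"
  let ?H = "\<lambda>A c. Pi_pmf A undefined (\<lambda>i. f i (\<Sum>j\<in>{1..i - 1}. c j) (c i))"
  let ?M = "\<lambda>c c' i. if i \<in> {0<..k} then c i else c' i :: int"
  have un: "{1..m} = {0<..k} \<union> {k<..m}" using assms by auto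
  have disj: "{0<..k} \<inter> {k<..m} = {}" by auto
  have H1: "?H {0<..k} (?M c c') = ?H {0<..k} c" for c c'
    by (intro Pi_pmf_cong refl arg_cong2[of _ _ _ _ "f _"] sum.cong) auto
  have H2: "?H {k<..m} (?M c c') = Pi_pmf {k<..m} undefined
      (\<lambda>i. f i ((\<Sum>j\<in>{1..k}. c j) + (\<Sum>j\<in>{k<..i - 1}. c' j)) (c' i))" for c c'
  proof (intro Pi_pmf_cong refl arg_cong2[of _ _ _ _ "f _"])
    fix i assume i: "i \<in> {k<..m}"
    then have "{1..i - 1} = {1..k} \<union> {k<..i - 1}" by auto
    then have "(\<Sum>j\<in>{1..i - 1}. ?M c c' j) = sum (?M c c') {1..k} + sum (?M c c') {k<..i - 1}"
      by (simp only:) (intro sum.union_disjoint, auto)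
    also have "\<dots> = (\<Sum>j\<in>{1..k}. c j) + (\<Sum>j\<in>{k<..i - 1}. c' j)"
      by (intro arg_cong2[of _ _ _ _ "(+)"] sum.cong) auto
    finally show "(\<Sum>j\<in>{1..i - 1}. ?M c c' j) = (\<Sum>j\<in>{1..k}. c j) + (\<Sum>j\<in>{k<..i - 1}. c' j)" .
  qed auto
  have "game m \<epsilon> f = bind_pmf (?C {0<..k}) (\<lambda>c. bind_pmf (?C {k<..m}) (\<lambda>c'.
      bind_pmf (?H {0<..k} (?M c c')) (\<lambda>h. bind_pmf (?H {k<..m} (?M c c')) (\<lambda>h'.
      return_pmf (concat_at k (c, h) (c', h'))))))"
    unfolding game_def un Pi_pmf_union[OF finite_greaterThanAtMost finite_greaterThanAtMost disj]
      concat_at_def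
    by (simp add: map_pmf_def pair_pmf_def bind_assoc_pmf bind_return_pmf cong: if_cong)
  \<comment> \<open>By \<open>H1\<close> the earlier hints do not read \<open>c'\<close>, so drawing
    them commutes with drawing the later coins.\<close>
  also have "\<dots> = bind_pmf (?C {0<..k}) (\<lambda>c. bind_pmf (?H {0<..k} c) (\<lambda>h.
      bind_pmf (?C {k<..m}) (\<lambda>c'. bind_pmf (?H {k<..m} (?M c c')) (\<lambda>h'.
      return_pmf (concat_at k (c, h) (c', h'))))))"
    unfolding H1 by (subst bind_commute_pmf) (rule refl)
  also have "\<dots> = bind_pmf (segment m \<epsilon> f 0 k 0) (\<lambda>\<omega>.
           map_pmf (concat_at k \<omega>) (segment m \<epsilon> f k m (partial_sum \<omega> k)))"
    unfolding H2 segment_def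
    by (simp add: map_pmf_def bind_assoc_pmf bind_return_pmf partial_sum_def coin_def
        atLeastSucAtMost_greaterThanAtMost)
  finally show ?thesis .
qed

section \<open>Markov property of the game\<close>

text \<open>
  The indices here are rounds: \<open>past_event k\<close> may use the hint of round \<open>k\<close>, while
  \<open>future_event m k\<close> sees rounds \<open>1, \<dots>, k\<close> only through the sum of their coins.
\<close>

definition past_event :: "nat \<Rightarrow> ('h outcome \<Rightarrow> bool) \<Rightarrow> bool" where
  "past_event k E \<longleftrightarrow> (\<forall>\<omega> \<omega>'.
     (\<forall>j\<in>{0<..k}. fst \<omega> j = fst \<omega>' j \<and> snd \<omega> j = snd \<omega>' j) \<longrightarrow> E \<omega> \<longrightarrow> E \<omega>')"

definition future_event :: "nat \<Rightarrow> nat \<Rightarrow> ('h outcome \<Rightarrow> bool) \<Rightarrow> bool" where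
  "future_event m k F \<longleftrightarrow> (\<forall>\<omega> \<omega>'. partial_sum \<omega> k = partial_sum \<omega>' k \<longrightarrow>
     (\<forall>j\<in>{k<..m}. fst \<omega> j = fst \<omega>' j \<and> snd \<omega> j = snd \<omega>' j) \<longrightarrow> F \<omega> \<longrightarrow> F \<omega>')"

text \<open>Given rounds up to \<open>k\<close>, the probability of \<open>F\<close> depends only on
  the coin sum, which \<open>E\<close> fixes to \<open>b\<close>. Choosing \<open>q\<close> before
  \<open>E\<close> lets one factor serve all past events, and the product form avoids conditioning
  on null events.\<close>

lemma game_markov:
  assumes "k \<le> m" and F: "future_event m k F"
  obtains q where "\<And>E. past_event k E \<Longrightarrow> (\<And>\<omega>. E \<omega> \<Longrightarrow> partial_sum \<omega> k = b) \<Longrightarrow>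
    emeasure (game m \<epsilon> f) {\<omega>. E \<omega> \<and> F \<omega>} = q * emeasure (game m \<epsilon> f) {\<omega>. E \<omega>}"
proof -
  define \<Omega> where "\<Omega> \<omega> = map_pmf (concat_at k \<omega>) (segment m \<epsilon> f k m (partial_sum \<omega> k))" for \<omega>
  let ?P = "segment m \<epsilon> f 0 k 0"
  have game: "emeasure (game m \<epsilon> f) X = (\<integral>\<^sup>+\<omega>. emeasure (\<Omega> \<omega>) X \<partial>?P)" for X
    unfolding game_split[OF assms(1)] \<Omega>_def by simp
  have sum_concat: "partial_sum (concat_at k \<omega> \<omega>') k = partial_sum \<omega> k" for \<omega> \<omega>' :: "'a outcome"
    by (rule partial_sum_cong) (simp add: concat_at_def)
  have F_imp: "F (concat_at k \<omega> x) \<Longrightarrow> F (concat_at k \<omega>' x)"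
    if "partial_sum \<omega> k = partial_sum \<omega>' k" for \<omega> \<omega>' x
    using F[unfolded future_event_def, rule_format, of "concat_at k \<omega> x" "concat_at k \<omega>' x"] that
    by (simp add: sum_concat) (simp add: concat_at_def)
  have F_eq: "F (concat_at k \<omega> x) \<longleftrightarrow> F (concat_at k \<omega>' x)"
    if "partial_sum \<omega> k = partial_sum \<omega>' k" for \<omega> \<omega>' x
    using F_imp[OF that] F_imp[OF that[symmetric]] by blast
  \<comment> \<open>If \<open>k = 0\<close> and \<open>b\<close> is nonzero, no outcome has this sum
    and the choice is arbitrary; then every admissible \<open>E\<close> is empty and both sides of
    the claim vanish.\<close>
  define \<omega>\<^sub>0 :: "'a outcome" where "\<omega>\<^sub>0 = (SOME \<omega>. partial_sum \<omega> k = b)"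
  define q where "q = emeasure (\<Omega> \<omega>\<^sub>0) {\<omega>. F \<omega>}"
  have q: "emeasure (\<Omega> \<omega>) {\<omega>. F \<omega>} = q" if "partial_sum \<omega> k = b" for \<omega>
  proof -
    have "partial_sum \<omega>\<^sub>0 k = b" unfolding \<omega>\<^sub>0_def using that by (rule someI)
    then show ?thesis
      unfolding q_def \<Omega>_def using that F_eq[of \<omega> \<omega>\<^sub>0] by (simp add: vimage_def)
  qed
  have "emeasure (game m \<epsilon> f) {\<omega>. E \<omega> \<and> F \<omega>} = q * emeasure (game m \<epsilon> f) {\<omega>. E \<omega>}"
    if E: "past_event k E" and Eb: "\<And>\<omega>. E \<omega> \<Longrightarrow> partial_sum \<omega> k = b" for E
  proof -
    have E_eq: "E (concat_at k \<omega> x) \<longleftrightarrow> E \<omega>" for \<omega> x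
      using E[unfolded past_event_def, rule_format, of \<omega> "concat_at k \<omega> x"]
        E[unfolded past_event_def, rule_format, of "concat_at k \<omega> x" \<omega>]
      by (auto simp: concat_at_def)
    \<comment> \<open>Applied with \<open>G\<close> equal to \<open>F\<close> and to
      \<open>True\<close>; the second instance is the reason for the conjunct \<open>True\<close> in
      the integral below.\<close>
    have *: "emeasure (\<Omega> \<omega>) {\<omega>. E \<omega> \<and> G \<omega>} = (if E \<omega> then emeasure (\<Omega> \<omega>) {\<omega>. G \<omega>} else 0)" for G \<omega>
      unfolding \<Omega>_def by (simp add: vimage_def E_eq)
    have "emeasure (game m \<epsilon> f) {\<omega>. E \<omega> \<and> F \<omega>}
        = (\<integral>\<^sup>+\<omega>. q * emeasure (\<Omega> \<omega>) {\<omega>. E \<omega> \<and> True} \<partial>?P)"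
      unfolding game * using q Eb measure_pmf.emeasure_space_1[of "\<Omega> _"]
      by (intro nn_integral_cong) auto
    also have "\<dots> = q * emeasure (game m \<epsilon> f) {\<omega>. E \<omega>}"
      unfolding game by (simp add: nn_integral_cmult)
    finally show ?thesis .
  qed
  then show thesis by (rule that)
qed

section \<open>Histories and the stopping state\<close>

lemma history_Suc:
  "history \<omega> (Suc k) = history \<omega> k @ [(partial_sum \<omega> k, hint \<omega> (Suc k))]"
  by (simp add: history_def)

lemma history_cong:
  assumes "\<And>j. j \<in> {0<..i} \<Longrightarrow> fst \<omega> j = fst \<omega>' j \<and> snd \<omega> j = snd \<omega>' j"
  shows "history \<omega> i = history \<omega>' i"
  unfolding history_def using assms
  by (auto simp: hint_def intro!: partial_sum_cong)

lemma abort_round_bounds: "abort_round m T r \<omega> \<in> {1..m + 1}"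
proof (cases "\<exists>i\<in>{1..m}. T r (history \<omega> i)")
  case True
  then have "\<exists>i. i \<in> {1..m} \<and> T r (history \<omega> i)" by blast
  from LeastI_ex[OF this] True show ?thesis
    unfolding abort_round_def by auto
qed (simp add: abort_round_def)

lemma abort_round_eq_iff:
  assumes "i \<in> {1..m}"
  shows "abort_round m T r \<omega> = i \<longleftrightarrow>
    T r (history \<omega> i) \<and> (\<forall>j\<in>{1..<i}. \<not> T r (history \<omega> j))"
proof (cases "\<exists>i\<in>{1..m}. T r (history \<omega> i)")
  case True
  let ?P = "\<lambda>i. i \<in> {1..m} \<and> T r (history \<omega> i)"
  have ex: "\<exists>i. ?P i" using True by blast
  have "(LEAST i. ?P i) = i \<longleftrightarrow> ?P i \<and> (\<forall>j. ?P j \<longrightarrow> i \<le> j)"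
  proof
    assume "(LEAST i. ?P i) = i"
    then show "?P i \<and> (\<forall>j. ?P j \<longrightarrow> i \<le> j)"
      using LeastI_ex[OF ex] Least_le[of ?P] by auto
  qed (rule Least_equality, auto)
  then show ?thesis
    using True assms unfolding abort_round_def
    by (auto simp: not_le[symmetric])
next
  case False
  then show ?thesis using assms unfolding abort_round_def by auto
qed

text \<open>The bracketed part depends only on rounds up to \<open>m - l\<close>, because the last
  entry of the history is replaced by the fixed pair \<open>(b, h)\<close>. The actual hint is left
  as a separate condition on the future.\<close>

lemma stop_state_With_Hint_iff:
  assumes "l \<in> {1..m}"
  shows "stop_state m T r \<omega> = With_Hint l b h \<longleftrightarrow>
    ((\<forall>j\<in>{1..m - l}. \<not> T r (history \<omega> j)) \<and> T r (history \<omega> (m - l) @ [(b, h)]) \<and>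
      partial_sum \<omega> (m - l) = b) \<and> hint \<omega> (m - l + 1) = h"
proof -
  let ?i = "abort_round m T r \<omega>"
  have "stop_state m T r \<omega> = With_Hint l b h \<longleftrightarrow>
      ?i = m - l + 1 \<and> partial_sum \<omega> (m - l) = b \<and> hint \<omega> (m - l + 1) = h"
    using assms abort_round_bounds[of m T r \<omega>] by (auto simp: stop_state_def Let_def)
  also have "?i = m - l + 1 \<longleftrightarrow>
      T r (history \<omega> (m - l + 1)) \<and> (\<forall>j\<in>{1..m - l}. \<not> T r (history \<omega> j))"
    using assms by (subst abort_round_eq_iff) (auto simp: atLeastLessThanSuc_atLeastAtMost)
  finally show ?thesis by (auto simp: history_Suc)
qed

lemma occurs_stop_state: "occurs m (stop_state m T r \<omega>) \<omega>"
  using abort_round_bounds[of m T r \<omega>] by (auto simp: stop_state_def Let_def)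

text \<open>A lower level means a later round, so the sum in \<open>v\<close> is the sum at round
  \<open>m - l\<close> plus later coins, and the hint in \<open>v\<close>, if any, belongs to a
  later round.\<close>

lemma future_event_occurs:
  assumes "l \<in> {1..m}" and "v \<in> V_hat m \<epsilon> f" and "level v < l"
  shows "future_event m (m - l) (occurs m v)"
proof -
  have sum: "partial_sum \<omega> (m - level v) = partial_sum \<omega>' (m - level v)"
    if "partial_sum \<omega> (m - l) = partial_sum \<omega>' (m - l)"
      and "\<forall>j\<in>{m - l<..m}. fst \<omega> j = fst \<omega>' j \<and> snd \<omega> j = snd \<omega>' j" for \<omega> \<omega>' :: "'a outcome"
  proof -
    have le: "m - l \<le> m - level v" using assms(3) by simp
    show ?thesis
      unfolding partial_sum_split[OF le] using that by (auto intro!: sum.cong)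
  qed
  show ?thesis
    unfolding future_event_def
  proof (intro allI impI)
    fix \<omega> \<omega>' :: "'a outcome"
    assume agree: "partial_sum \<omega> (m - l) = partial_sum \<omega>' (m - l)"
      "\<forall>j\<in>{m - l<..m}. fst \<omega> j = fst \<omega>' j \<and> snd \<omega> j = snd \<omega>' j"
      and occ: "occurs m v \<omega>"
    from assms(2) consider l' b h where "v = With_Hint l' b h" "l' \<in> {1..m}"
      | b where "v = Without_Hint 0 b"
      unfolding V_hat_def by auto
    then show "occurs m v \<omega>'"
    proof cases
      case 1
      \<comment> \<open>The bound \<open>l' \<ge> 1\<close> from \<open>V_hat\<close> keeps the
        round of this hint at most \<open>m\<close>.\<close>
      then have "m - level v + 1 \<in> {m - l<..m}" using assms by auto
      with agree(2) have "hint \<omega> (m - level v + 1) = hint \<omega>' (m - level v + 1)"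
        unfolding hint_def by blast
      with 1 occ sum[OF agree] show ?thesis by simp
    next
      case 2
      with occ sum[OF agree] show ?thesis by simp
    qed
  qed
qed

section \<open>Measurability and integration on the joint space\<close>

locale strategy =
  fixes m :: nat and \<epsilon> :: real and f :: "'h hint_fun"
    and R :: "'r measure" and T :: "'r \<Rightarrow> (int \<times> 'h) list \<Rightarrow> bool"
  assumes is_strategy: "is_strategy R T"
begin

abbreviation "J \<equiv> joint_space R m \<epsilon> f"
abbreviation "U x \<equiv> stop_state m T (fst x) (snd x)"

sublocale R: prob_space R
  using is_strategy by (simp add: is_strategy_def)

sublocale pair_prob_space R "measure_pmf (game m \<epsilon> f)" ..

sublocale J: prob_space J
  unfolding joint_space_def by unfold_locales

lemma space_J: "space J = space R \<times> UNIV"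
  by (simp add: joint_space_def space_pair_measure)

lemma measurable_outcome: "(\<lambda>x. g (snd x)) \<in> J \<rightarrow>\<^sub>M count_space UNIV"
  unfolding joint_space_def by (rule measurable_compose[OF measurable_snd]) simp

lemma measurable_T: "(\<lambda>x. T (fst x) (g (snd x))) \<in> J \<rightarrow>\<^sub>M count_space UNIV"
proof -
  have T: "(\<lambda>(r, xs). T r xs) \<in> R \<Otimes>\<^sub>M count_space UNIV \<rightarrow>\<^sub>M count_space UNIV"
    using is_strategy by (simp add: is_strategy_def)
  have "(\<lambda>x. (fst x, g (snd x))) \<in> J \<rightarrow>\<^sub>M R \<Otimes>\<^sub>M count_space UNIV"
    using measurable_outcome[of g] by (intro measurable_Pair) (auto simp: joint_space_def)
  from measurable_compose[OF this T] show ?thesis by simp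
qed

lemma measurable_U: "U \<in> J \<rightarrow>\<^sub>M count_space UNIV"
proof -
  have [measurable]: "(\<lambda>x. T (fst x) (history (snd x) i)) \<in> J \<rightarrow>\<^sub>M count_space UNIV" for i
    by (rule measurable_T)
  have [measurable]: "(\<lambda>x. abort_round m T (fst x) (snd x)) \<in> J \<rightarrow>\<^sub>M count_space UNIV"
    unfolding abort_round_def by measurable
  \<comment> \<open>There may be uncountably many states, but the abort round is a natural number;
    once it is fixed, the state is a function of the discrete outcome alone.\<close>
  show ?thesis
    unfolding stop_state_def Let_def
    by (rule measurable_compose_countable[where f = "\<lambda>i x.
          if i \<le> m then With_Hint (m - i + 1) (partial_sum (snd x) (i - 1)) (hint (snd x) i)
          else Without_Hint 0 (partial_sum (snd x) m)"], rule measurable_outcome) measurable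
qed

lemma emeasure_J:
  assumes "{x \<in> space J. P (fst x) (snd x)} \<in> sets J"
  shows "emeasure J {x \<in> space J. P (fst x) (snd x)} =
    (\<integral>\<^sup>+r. emeasure (game m \<epsilon> f) {\<omega>. P r \<omega>} \<partial>R)"
proof -
  have "emeasure J {x \<in> space J. P (fst x) (snd x)} = (\<integral>\<^sup>+r. emeasure (game m \<epsilon> f)
      (Pair r -` {x \<in> space J. P (fst x) (snd x)}) \<partial>R)"
    using assms unfolding joint_space_def by (rule measure_pmf.emeasure_pair_measure_alt)
  also have "\<dots> = (\<integral>\<^sup>+r. emeasure (game m \<epsilon> f) {\<omega>. P r \<omega>} \<partial>R)"
    by (intro nn_integral_cong arg_cong2[of _ _ _ _ emeasure]) (auto simp: space_J)
  finally show ?thesis .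
qed

text \<open>The factor \<open>q\<close> is the same for every \<open>r\<close>, so it can be pulled
  out of the integral over the private randomness. This carries the Markov property from the game to
  the joint space.\<close>

lemma emeasure_J_cmult:
  assumes P: "{x \<in> space J. P (fst x) (snd x)} \<in> sets J"
    and Q: "{x \<in> space J. Q (fst x) (snd x)} \<in> sets J"
    and eq: "\<And>r. emeasure (game m \<epsilon> f) {\<omega>. P r \<omega>} = q * emeasure (game m \<epsilon> f) {\<omega>. Q r \<omega>}"
  shows "emeasure J {x \<in> space J. P (fst x) (snd x)} =
    q * emeasure J {x \<in> space J. Q (fst x) (snd x)}"
proof -
  have "(\<lambda>r. emeasure (game m \<epsilon> f) (Pair r -` {x \<in> space J. Q (fst x) (snd x)})) \<in> borel_measurable R"
    using Q unfolding joint_space_def by (rule measure_pmf.measurable_emeasure_Pair)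
  also have "?this \<longleftrightarrow> (\<lambda>r. emeasure (game m \<epsilon> f) {\<omega>. Q r \<omega>}) \<in> borel_measurable R"
    by (intro measurable_cong arg_cong2[of _ _ _ _ emeasure]) (auto simp: space_J)
  finally show ?thesis
    unfolding emeasure_J[OF P] emeasure_J[OF Q] eq by (rule nn_integral_cmult)
qed

lemma measure_J_outcome: "measure J {x \<in> space J. P (snd x)} = measure (game m \<epsilon> f) {\<omega>. P \<omega>}"
proof -
  have "{x \<in> space J. P (snd x)} \<in> sets J"
    using measurable_outcome[of P] by simp
  from emeasure_J[of "\<lambda>_. P", OF this]
  have "emeasure J {x \<in> space J. P (snd x)} = emeasure (game m \<epsilon> f) {\<omega>. P \<omega>}"
    by (simp add: R.emeasure_space_1)
  then show ?thesis by (simp add: measure_def)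
qed

section \<open>Constraints of the linear program\<close>

text \<open>
  In the proof the game is cut before the hint of \<open>u\<close>, so that this hint is part of the future and the past
  event \<open>E\<close> says that the strategy would stop if it now received \<open>h\<close>.
\<close>

lemma stop_markov:
  assumes l: "l \<in> {1..m}" and u: "u = With_Hint l b h" and pos: "state_prob m \<epsilon> f u > 0"
    and v: "future_event m (m - l) (occurs m v)"
  shows "measure J {x \<in> space J. U x = u \<and> occurs m v (snd x)} =
    stop_prob m \<epsilon> f R T u * trans_prob m \<epsilon> f u v"
proof -
  define k where "k = m - l"
  have k: "k \<le> m" "k + 1 \<le> m" using l by (auto simp: k_def)
  let ?G = "game m \<epsilon> f"
  define E where "E r \<omega> \<longleftrightarrow> (\<forall>j\<in>{1..k}. \<not> T r (history \<omega> j)) \<and> T r (history \<omega> k @ [(b, h)]) \<and>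
      partial_sum \<omega> k = b" for r \<omega>
  have U: "U x = u \<longleftrightarrow> E (fst x) (snd x) \<and> hint (snd x) (k + 1) = h" for x
    unfolding u k_def E_def stop_state_With_Hint_iff[OF l] ..
  have past: "past_event k (E r)" for r
    unfolding past_event_def
  proof (intro allI impI)
    fix \<omega> \<omega>' :: "'h outcome"
    assume *: "\<forall>j\<in>{0<..k}. fst \<omega> j = fst \<omega>' j \<and> snd \<omega> j = snd \<omega>' j" "E r \<omega>"
    have "history \<omega> j = history \<omega>' j" if "j \<le> k" for j
      using * that by (intro history_cong) auto
    moreover have "partial_sum \<omega> k = partial_sum \<omega>' k"
      using * by (intro partial_sum_cong) auto
    ultimately show "E r \<omega>'" using *(2) by (simp add: E_def)
  qed
  \<comment> \<open>The largest past event that the Markov property admits; it accounts for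
    \<open>Pr[u]\<close> and \<open>Pr[v, u]\<close>, as \<open>E r\<close> does for stopping in
    \<open>u\<close>.\<close>
  have past': "past_event k (\<lambda>\<omega> :: 'h outcome. partial_sum \<omega> k = b)"
    unfolding past_event_def
  proof (intro allI impI)
    fix \<omega> \<omega>' :: "'h outcome"
    assume "\<forall>j\<in>{0<..k}. fst \<omega> j = fst \<omega>' j \<and> snd \<omega> j = snd \<omega>' j" "partial_sum \<omega> k = b"
    then show "partial_sum \<omega>' k = b" using partial_sum_cong[of k \<omega> \<omega>'] by simp
  qed
  have "future_event m k (\<lambda>\<omega>. hint \<omega> (k + 1) = h)"
    using k by (auto simp: future_event_def hint_def)
  \<comment> \<open>\<open>q1\<close> acts as the probability of the hint \<open>h\<close> given the
    sum \<open>b\<close>, and \<open>q2\<close> below as that of the hint together with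
    \<open>v\<close>.\<close>
  from game_markov[OF k(1) this, of b \<epsilon> f] obtain q1 where q1:
    "\<And>E. past_event k E \<Longrightarrow> (\<And>\<omega>. E \<omega> \<Longrightarrow> partial_sum \<omega> k = b) \<Longrightarrow>
      emeasure ?G {\<omega>. E \<omega> \<and> hint \<omega> (k + 1) = h} = q1 * emeasure ?G {\<omega>. E \<omega>}"
    by blast
  have "future_event m k (\<lambda>\<omega>. hint \<omega> (k + 1) = h \<and> occurs m v \<omega>)"
    unfolding future_event_def
  proof (intro allI impI)
    fix \<omega> \<omega>' :: "'h outcome"
    assume *: "partial_sum \<omega> k = partial_sum \<omega>' k"
      "\<forall>j\<in>{k<..m}. fst \<omega> j = fst \<omega>' j \<and> snd \<omega> j = snd \<omega>' j"
      "hint \<omega> (k + 1) = h \<and> occurs m v \<omega>"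
    then have "occurs m v \<omega>'"
      using v[folded k_def, unfolded future_event_def] by blast
    moreover have "hint \<omega>' (k + 1) = hint \<omega> (k + 1)"
      using *(2) k unfolding hint_def by simp
    ultimately show "hint \<omega>' (k + 1) = h \<and> occurs m v \<omega>'"
      using *(3) by simp
  qed
  from game_markov[OF k(1) this, of b \<epsilon> f] obtain q2 where q2:
    "\<And>E. past_event k E \<Longrightarrow> (\<And>\<omega>. E \<omega> \<Longrightarrow> partial_sum \<omega> k = b) \<Longrightarrow>
      emeasure ?G {\<omega>. E \<omega> \<and> hint \<omega> (k + 1) = h \<and> occurs m v \<omega>} = q2 * emeasure ?G {\<omega>. E \<omega>}"
    by blast
  have E_meas: "(\<lambda>x. E (fst x) (snd x)) \<in> J \<rightarrow>\<^sub>M count_space UNIV"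
  proof -
    have [measurable]: "(\<lambda>x. T (fst x) (history (snd x) j)) \<in> J \<rightarrow>\<^sub>M count_space UNIV"
      "(\<lambda>x. T (fst x) (history (snd x) k @ [(b, h)])) \<in> J \<rightarrow>\<^sub>M count_space UNIV"
      "(\<lambda>x. partial_sum (snd x) k = b) \<in> J \<rightarrow>\<^sub>M count_space UNIV" for j
      by (rule measurable_T measurable_outcome)+
    show ?thesis unfolding E_def by measurable
  qed
  have sets: "{x \<in> space J. E (fst x) (snd x) \<and> g (snd x)} \<in> sets J" for g
    using E_meas measurable_outcome[of g] by simp
  from this[of "\<lambda>_. True"] have E_sets: "{x \<in> space J. E (fst x) (snd x)} \<in> sets J"
    by simp
  define e where "e = emeasure J {x \<in> space J. E (fst x) (snd x)}"
  have J1: "emeasure J {x \<in> space J. U x = u} = q1 * e"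
    unfolding U e_def
    using q1[OF past] sets E_sets by (intro emeasure_J_cmult[where P = "\<lambda>r \<omega>. E r \<omega> \<and> hint \<omega> (k + 1) = h"])
      (auto simp: E_def)
  have J2: "emeasure J {x \<in> space J. U x = u \<and> occurs m v (snd x)} = q2 * e"
    unfolding U e_def conj_assoc
    using q2[OF past] sets E_sets
    by (intro emeasure_J_cmult[where P = "\<lambda>r \<omega>. E r \<omega> \<and> hint \<omega> (k + 1) = h \<and> occurs m v \<omega>"])
      (auto simp: E_def)
  have G1: "emeasure ?G {\<omega>. occurs m u \<omega>} = q1 * emeasure ?G {\<omega>. partial_sum \<omega> k = b}"
    using q1[OF past'] by (simp add: u k_def)
  have G2: "emeasure ?G {\<omega>. occurs m v \<omega> \<and> occurs m u \<omega>} = q2 * emeasure ?G {\<omega>. partial_sum \<omega> k = b}"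
    using q2[OF past'] by (simp add: u k_def conj_ac)
  \<comment> \<open>Both sides equal \<open>q1 * q2 * e\<close> times the probability of the sum
    \<open>b\<close>. The cross-multiplied form postpones division to the reals, where
    \<open>pos\<close> justifies it.\<close>
  have "emeasure J {x \<in> space J. U x = u \<and> occurs m v (snd x)} * emeasure ?G {\<omega>. occurs m u \<omega>} =
      emeasure J {x \<in> space J. U x = u} * emeasure ?G {\<omega>. occurs m v \<omega> \<and> occurs m u \<omega>}"
    unfolding J1 J2 G1 G2 by (simp add: mult_ac)
  then have "measure J {x \<in> space J. U x = u \<and> occurs m v (snd x)} * measure ?G {\<omega>. occurs m u \<omega>} =
      measure J {x \<in> space J. U x = u} * measure ?G {\<omega>. occurs m v \<omega> \<and> occurs m u \<omega>}"
    by (simp add: J.emeasure_eq_measure measure_pmf.emeasure_eq_measure ennreal_mult'[symmetric])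
  then show ?thesis
    using pos by (simp add: stop_prob_def trans_prob_def cond_prob_def state_prob_def field_simps)
qed

text \<open>The terms are nonnegative, so this bound on finite subsums yields both the summability
  and the bound on the infinite sum.\<close>

lemma stop_prob_feasible:
  assumes v: "v \<in> V_hat m \<epsilon> f" and F: "finite F" "F \<subseteq> {u \<in> V_hat m \<epsilon> f. earlier u v}"
  shows "stop_prob m \<epsilon> f R T v + (\<Sum>u\<in>F. stop_prob m \<epsilon> f R T u * trans_prob m \<epsilon> f u v)
    \<le> state_prob m \<epsilon> f v"
proof -
  define A where "A u = {x \<in> space J. U x = u \<and> occurs m v (snd x)}" for u
  note [measurable] = measurable_U measurable_outcome[of "occurs m v"]
  have A: "A u \<in> sets J" for u
    unfolding A_def by measurable
  have "measure J (A u) = stop_prob m \<epsilon> f R T u * trans_prob m \<epsilon> f u v" if "u \<in> F" for u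
  proof -
    have u: "u \<in> V_hat m \<epsilon> f" "level v < level u"
      using that F(2) by (auto simp: earlier_def)
    \<comment> \<open>The level of \<open>u\<close> exceeds that of \<open>v\<close>, hence is
      positive, which excludes final states.\<close>
    then obtain l b h where l: "l \<in> {1..m}" "u = With_Hint l b h" "state_prob m \<epsilon> f u > 0"
      unfolding V_hat_def by auto
    have "future_event m (m - l) (occurs m v)"
      using u l by (intro future_event_occurs[OF l(1) v]) simp
    with l show ?thesis
      unfolding A_def by (intro stop_markov)
  qed
  then have "(\<Sum>u\<in>F. stop_prob m \<epsilon> f R T u * trans_prob m \<epsilon> f u v) = (\<Sum>u\<in>F. measure J (A u))"
    by simp
  \<comment> \<open>Stopping in \<open>v\<close> entails that \<open>v\<close> occurs, so the second
    conjunct of \<open>A v\<close> holds automatically.\<close>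
  moreover have "stop_prob m \<epsilon> f R T v = measure J (A v)"
    unfolding stop_prob_def A_def using occurs_stop_state by (metis (lifting))
  moreover have "v \<notin> F" using F(2) by (auto simp: earlier_def)
  ultimately have "stop_prob m \<epsilon> f R T v + (\<Sum>u\<in>F. stop_prob m \<epsilon> f R T u * trans_prob m \<epsilon> f u v)
      = (\<Sum>u\<in>insert v F. measure J (A u))"
    using F(1) by simp
  also have "\<dots> = measure J (\<Union>u\<in>insert v F. A u)"
    using F(1) A by (intro J.finite_measure_finite_Union[symmetric])
      (auto simp: A_def disjoint_family_on_def)
  also have "\<dots> \<le> measure J {x \<in> space J. occurs m v (snd x)}"
    by (intro J.finite_measure_mono) (auto simp: A_def)
  also have "\<dots> = state_prob m \<epsilon> f v"
    by (simp add: measure_J_outcome state_prob_def)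
  finally show ?thesis .
qed

lemma lp_feasible_stop_prob: "lp_feasible m \<epsilon> f (stop_prob m \<epsilon> f R T)"
  unfolding lp_feasible_def
proof (intro conjI ballI)
  fix v assume v: "v \<in> V_hat m \<epsilon> f"
  let ?t = "\<lambda>u. stop_prob m \<epsilon> f R T u * trans_prob m \<epsilon> f u v"
  let ?V = "{u \<in> V_hat m \<epsilon> f. earlier u v}"
  have bound: "sum ?t F \<le> state_prob m \<epsilon> f v - stop_prob m \<epsilon> f R T v" if "finite F" "F \<subseteq> ?V" for F
    using stop_prob_feasible[OF v that] by simp
  show summable: "?t summable_on ?V"
  proof (rule nonneg_bdd_above_summable_on)
    show "bdd_above (sum ?t ` {F. F \<subseteq> ?V \<and> finite F})"
      by (rule bdd_aboveI2, rule bound) auto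
  qed (simp add: stop_prob_def trans_prob_def cond_prob_def)
  show "stop_prob m \<epsilon> f R T v + infsum ?t ?V \<le> state_prob m \<epsilon> f v"
    using infsum_le_finite_sums[OF summable bound] by simp
qed (simp add: stop_prob_def)

section \<open>Law of the stopping state and the objective value\<close>

text \<open>A state of positive probability occurs at some outcome in the countable support of the
  game. The type of hints itself may be uncountable.\<close>

lemma countable_V_hat: "countable (V_hat m \<epsilon> f)"
proof -
  have "V_hat m \<epsilon> f \<subseteq> (\<lambda>(l, \<omega>). With_Hint l (partial_sum \<omega> (m - l)) (hint \<omega> (m - l + 1))) `
      (UNIV \<times> set_pmf (game m \<epsilon> f)) \<union> range (Without_Hint 0)"
  proof
    fix v assume v: "v \<in> V_hat m \<epsilon> f"
    then have "measure (game m \<epsilon> f) {\<omega>. occurs m v \<omega>} \<noteq> 0"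
      by (auto simp: V_hat_def state_prob_def)
    then obtain \<omega> where "\<omega> \<in> set_pmf (game m \<epsilon> f)" "occurs m v \<omega>"
      by (auto simp: measure_pmf_zero_iff)
    with v show "v \<in> (\<lambda>(l, \<omega>). With_Hint l (partial_sum \<omega> (m - l)) (hint \<omega> (m - l + 1))) `
      (UNIV \<times> set_pmf (game m \<epsilon> f)) \<union> range (Without_Hint 0)"
      by (force simp: V_hat_def)
  qed
  then show ?thesis
    by (rule countable_subset) (auto intro!: countable_Un countable_image countable_SIGMA)
qed

text \<open>Almost surely the outcome lies in the support of the game; the stopping state occurs at
  this outcome and so has positive probability.\<close>

lemma AE_U_in_V_hat: "AE x in J. U x \<in> V_hat m \<epsilon> f"
proof -
  have "measure J {x \<in> space J. snd x \<in> - set_pmf (game m \<epsilon> f)} = 0"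
    using measure_J_outcome[of "\<lambda>\<omega>. \<omega> \<in> - set_pmf (game m \<epsilon> f)"]
    by (auto simp: measure_pmf_zero_iff)
  moreover have "{x \<in> space J. snd x \<in> - set_pmf (game m \<epsilon> f)} \<in> sets J"
    using measurable_outcome[of "\<lambda>\<omega>. \<omega> \<in> - set_pmf (game m \<epsilon> f)"] by simp
  ultimately have "AE x in J. snd x \<in> set_pmf (game m \<epsilon> f)"
    by (intro AE_I[where N = "{x \<in> space J. snd x \<in> - set_pmf (game m \<epsilon> f)}"])
      (auto simp: J.emeasure_eq_measure)
  then show ?thesis
  proof (rule AE_mp, intro AE_I2 impI)
    fix x :: "'r \<times> 'h outcome" assume x: "snd x \<in> set_pmf (game m \<epsilon> f)"
    have "state_prob m \<epsilon> f (U x) \<noteq> 0"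
      using x occurs_stop_state[of m T "fst x" "snd x"]
      by (auto simp: state_prob_def measure_pmf_zero_iff)
    then have "state_prob m \<epsilon> f (U x) > 0"
      by (simp add: state_prob_def zero_less_measure_iff)
    moreover have "(\<exists>l\<in>{1..m}. \<exists>b h. U x = With_Hint l b h) \<or> (\<exists>b. U x = Without_Hint 0 b)"
      using abort_round_bounds[of m T "fst x" "snd x"] by (auto simp: stop_state_def Let_def)
    ultimately show "U x \<in> V_hat m \<epsilon> f"
      by (simp add: V_hat_def)
  qed
qed

text \<open>Being concentrated on a countable set, the law of \<open>U\<close> is discrete; as a pmf
  it turns expectations into sums over states.\<close>

lemma stop_pmf:
  obtains p where "measure_pmf p = distr J (count_space UNIV) U"
    and "pmf p = stop_prob m \<epsilon> f R T" and "set_pmf p \<subseteq> V_hat m \<epsilon> f"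
proof -
  let ?D = "distr J (count_space UNIV) U"
  have D: "measure ?D {v} = stop_prob m \<epsilon> f R T v" for v
    using measurable_U by (subst measure_distr)
      (auto simp: stop_prob_def intro!: arg_cong2[of _ _ _ _ measure])
  have AE_V: "AE v in ?D. v \<in> V_hat m \<epsilon> f"
    using AE_U_in_V_hat measurable_U by (subst AE_distr_iff) auto
  interpret D: prob_space ?D
    by (rule J.prob_space_distr[OF measurable_U])
  \<comment> \<open>A countable union of null points is null, so almost every state is an atom, as
    \<open>Abs_pmf_inverse\<close> demands.\<close>
  let ?N = "{v \<in> V_hat m \<epsilon> f. measure ?D {v} = 0}"
  have "AE v in ?D. v \<notin> ?N"
    using countable_V_hat by (intro AE_discrete_difference)
      (auto simp: D.emeasure_eq_measure intro: countable_subset)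
  with AE_V have "AE v in ?D. measure ?D {v} \<noteq> 0"
    by eventually_elim auto
  then have *: "measure_pmf (Abs_pmf ?D) = ?D"
    by (intro Abs_pmf_inverse) (auto intro: D.prob_space_axioms)
  show thesis
  proof
    show "measure_pmf (Abs_pmf ?D) = ?D" by fact
    show "pmf (Abs_pmf ?D) = stop_prob m \<epsilon> f R T"
      unfolding pmf.rep_eq * D ..
    show "set_pmf (Abs_pmf ?D) \<subseteq> V_hat m \<epsilon> f"
    proof -
      have "AE v in measure_pmf (Abs_pmf ?D). v \<in> V_hat m \<epsilon> f"
        using AE_V by (simp only: *)
      then show ?thesis unfolding AE_measure_pmf_iff by blast
    qed
  qed
qed

text \<open>A bounded \<open>g\<close> is integrable under the law of \<open>U\<close>; writing this
  law as a density over the counting measure, integrability becomes absolute summability.\<close>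

lemma has_sum_stop_prob:
  fixes g :: "'h state \<Rightarrow> real"
  assumes "\<And>v. \<bar>g v\<bar> \<le> B"
  shows "((\<lambda>v. stop_prob m \<epsilon> f R T v * g v) has_sum (LINT x|J. g (U x))) (V_hat m \<epsilon> f)"
proof -
  obtain p where p: "measure_pmf p = distr J (count_space UNIV) U"
    "pmf p = stop_prob m \<epsilon> f R T" "set_pmf p \<subseteq> V_hat m \<epsilon> f"
    by (rule stop_pmf)
  let ?h = "\<lambda>v. pmf p v * g v"
  have "integrable (measure_pmf p) g"
    using assms by (intro measure_pmf.integrable_const_bound[where B = B]) auto
  then have abs: "Infinite_Set_Sum.abs_summable_on ?h UNIV"
    unfolding measure_pmf_eq_density
    by (subst (asm) integrable_density) (auto simp: Infinite_Set_Sum.abs_summable_on_def)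
  have "(LINT x|J. g (U x)) = measure_pmf.expectation p g"
    unfolding p(1) using measurable_U by (subst integral_distr) auto
  also have "\<dots> = infsum ?h UNIV"
    unfolding pmf_expectation_eq_infsetsum by (rule infsetsum_infsum[OF abs])
  finally have "(?h has_sum (LINT x|J. g (U x))) UNIV"
    using abs abs_summable_equivalent abs_summable_summable has_sum_infsum by metis
  \<comment> \<open>Outside \<open>V_hat\<close> the weights \<open>pmf p\<close> vanish.\<close>
  also have "?this \<longleftrightarrow> (?h has_sum (LINT x|J. g (U x))) (V_hat m \<epsilon> f)"
    using p(3) by (intro has_sum_cong_neutral) (auto simp: set_pmf_iff)
  finally show ?thesis unfolding p(2) .
qed

text \<open>The integrands agree pointwise: round \<open>i\<close> has level
  \<open>m - i + 1\<close>, and after a run without abort both differences are 0 because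
  \<open>drop_hint\<close> fixes final states.\<close>

lemma bias_eq:
  "bias m \<epsilon> f R T = (LINT x|J. state_c m \<epsilon> f (U x) - state_v m \<epsilon> f (U x))"
proof -
  have "O_minus m \<epsilon> f i \<omega> - O_hint m \<epsilon> f i \<omega> =
      state_c m \<epsilon> f (stop_state m T r \<omega>) - state_v m \<epsilon> f (stop_state m T r \<omega>)"
    if "i = abort_round m T r \<omega>" for r \<omega> i
    using abort_round_bounds[of m T r \<omega>] that
    by (auto simp: O_minus_def O_hint_def delta_def delta_hint_def stop_state_def Let_def
        state_c_def state_v_def)
  then show ?thesis
    unfolding bias_def case_prod_unfold by simp
qed

end

theorem lemma5p4:
  fixes m :: nat and \<epsilon> :: real and f :: "'h hint_fun"
    and R :: "'r measure" and T :: "'r \<Rightarrow> (int \<times> 'h) list \<Rightarrow> bool"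
  assumes "\<epsilon> \<in> {-1..1}" and "is_strategy R T"
  shows "lp_feasible m \<epsilon> f (stop_prob m \<epsilon> f R T) \<and>
    (\<lambda>v. stop_prob m \<epsilon> f R T v * (state_c m \<epsilon> f v - state_v m \<epsilon> f v))
      summable_on V_hat m \<epsilon> f \<and>
    lp_objective m \<epsilon> f (stop_prob m \<epsilon> f R T) = bias m \<epsilon> f R T"
proof -
  interpret strategy m \<epsilon> f R T by unfold_locales (rule assms(2))
  \<comment> \<open>Division by zero gives 0, so the bound also covers states of probability
    0.\<close>
  have bound: "\<bar>state_c m \<epsilon> f v - state_v m \<epsilon> f v\<bar> \<le> 1" for v
  proof -
    have "0 \<le> state_c m \<epsilon> f v" "state_c m \<epsilon> f v \<le> 1" "0 \<le> state_v m \<epsilon> f v" "state_v m \<epsilon> f v \<le> 1"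
      unfolding state_c_def state_v_def cond_prob_def
      by (auto intro!: divide_le_eq_1[THEN iffD2] measure_pmf.finite_measure_mono
          simp: zero_less_measure_iff)
    then show ?thesis by linarith
  qed
  have "((\<lambda>v. stop_prob m \<epsilon> f R T v * (state_c m \<epsilon> f v - state_v m \<epsilon> f v)) has_sum
      bias m \<epsilon> f R T) (V_hat m \<epsilon> f)"
    unfolding bias_eq by (rule has_sum_stop_prob[OF bound])
  then show ?thesis
    using lp_feasible_stop_prob has_sum_imp_summable infsumI
    unfolding lp_objective_def by blast
qed

end
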